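(* Every integer $x > 43$ is a McNugget number; that is, for every integer $x > 43$ there exist nonnegative integers $a, b, c$ such that $6a + 9b + 20c = x$.
   Context: A nonnegative integer $n$ is called a McNugget number if there is an ordered triple $(a,b,c)$ of nonnegative integers with $6a + 9b + 20c = n$. *)

theory Defs
  imports Main
begin

definition McNugget_number :: "int \<Rightarrow> bool" where
  "McNugget_number n \<longleftrightarrow>
     n \<ge> 0 \<and> (\<exists>a b c :: int. a \<ge> 0 \<and> b \<ge> 0 \<and> c \<ge> 0 \<and> 6 * a + 9 * b + 20 * c = n)"

end

theory Submission
  imports Defs
begin

text \<open>Since \<open>20 \<equiv> -1 (mod 3)\<close>, some \<open>c \<in> {0, 1, 2}\<close> makes \<open>x - 20 c\<close> a multiple
  \<open>3 k\<close> of 3, and \<open>x > 43\<close> forces \<open>k \<ge> 2\<close>. Every \<open>k \<ge> 2\<close> has the form \<open>2 a + 3 b\<close>.\<close>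

theorem proposition1p1:
  fixes x :: int
  assumes "x > 43"
  shows "McNugget_number x"
proof -
  define c where "c = (- x) mod 3"
  define k where "k = (x - 20 * c) div 3"
  \<comment> \<open>Taking \<open>b\<close> as the parity of \<open>k\<close> makes
    \<open>k - 3 * b\<close> even, so the halving in \<open>a\<close> is exact.\<close>
  define b where "b = k mod 2"
  define a where "a = (k - 3 * b) div 2"
  have c: "0 \<le> c" "c \<le> 2" and "(x + c) mod 3 = 0"
    unfolding c_def by (simp_all add: mod_simps)
  \<comment> \<open>\<open>x + c\<close> and \<open>x - 20 * c\<close> differ by
    \<open>21 * c\<close>.\<close>
  then have "(x - 20 * c) mod 3 = 0"
    by presburger
  then have x: "x = 3 * k + 20 * c"
    unfolding k_def by presburger
  \<comment> \<open>\<open>3 * k \<ge> 44 - 40 = 4\<close>, hence \<open>k \<ge> 2\<close> by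
    integrality; \<open>x = 43\<close> would give \<open>c = 2\<close> and
    \<open>k = 1\<close>.\<close>
  with assms c have "k \<ge> 2"
    by presburger
  \<comment> \<open>For \<open>a \<ge> 0\<close> with \<open>k\<close> odd: \<open>k \<ge> 2\<close>
    then means \<open>k \<ge> 3\<close>.\<close>
  then have "a \<ge> 0" "b \<ge> 0" and k: "k = 2 * a + 3 * b"
    unfolding a_def b_def by presburger+
  moreover from x k have "6 * a + 9 * b + 20 * c = x"
    by simp
  ultimately show ?thesis
    using assms c unfolding McNugget_number_def by auto
qed

end
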